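(* Let $ABC$ be a nondegenerate triangle in the Euclidean plane, and let $P,Q,R$ be three non-collinear points of the plane, identified with their normalized barycentric coordinate row vectors with respect to $ABC$. Then $$\cot\measuredangle QPR=\frac{(P-Q)\,K\,(P-R)^T}{2S_{\triangle ABC}\,[P;Q;R]}.$$
   Context: The normalized barycentric coordinates of a point $P$ with respect to $ABC$ are the unique row vector $P=[\alpha_P\ \beta_P\ \gamma_P]$ with $\alpha_P+\beta_P+\gamma_P=1$ such that the position of $P$ (in Cartesian coordinates) is $\alpha_P A+\beta_P B+\gamma_P C$. The same letter denotes a point and its barycentric row vector. With $a=|BC|$, $b=|CA|$, $c=|AB|$, put $S_A=\frac12(b^2+c^2-a^2)$, $S_B=\frac12(c^2+a^2-b^2)$, $S_C=\frac12(a^2+b^2-c^2)$, and $K=\mathrm{diag}(S_A,S_B,S_C)$. $S_{\triangle XYZ}$ denotes the oriented area of triangle $XYZ$ (positive when $X,Y,Z$ are in counterclockwise order), i.e. $\frac12\det\begin{bmatrix}x_X&x_Y&x_Z\\ y_X&y_Y&y_Z\\ 1&1&1\end{bmatrix}$ in Cartesian coordinates. $[P;Q;R]$ denotes the determinant of the $3\times3$ matrix whose rows are the barycentric row vectors $P,Q,R$. $\measuredangle QPR$ denotes the directed angle at $P$ from ray $PQ$ to ray $PR$, counted positive when $Q,P,R$ are in clockwise order (equivalently $P,Q,R$ are in counterclockwise order), so that $|PQ|\,|PR|\sin\measuredangle QPR=2S_{\triangle PQR}$ and $|PQ|\,|PR|\cos\measuredangle QPR=\overrightarrow{PQ}\cdot\overrightarrow{PR}$.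 *)

theory Defs
  imports "HOL-Analysis.Analysis"
begin

text \<open>
  The Euclidean plane is modelled by \<^typ>\<open>complex\<close>, with Cartesian coordinates
  \<^const>\<open>Re\<close> and \<^const>\<open>Im\<close>. The entries \<open>v $ 1\<close>, \<open>v $ 2\<close>, \<open>v $ 3\<close> of a row vector in
  \<^typ>\<open>real^3\<close> belong to \<open>A\<close>, \<open>B\<close>, \<open>C\<close>, in this order.
\<close>

definition bary :: "complex \<Rightarrow> complex \<Rightarrow> complex \<Rightarrow> complex \<Rightarrow> real^3" where
  "bary A B C P =
    (THE v. v $ 1 + v $ 2 + v $ 3 = 1 \<and> P = v $ 1 *\<^sub>R A + v $ 2 *\<^sub>R B + v $ 3 *\<^sub>R C)"

definition conway_A :: "complex \<Rightarrow> complex \<Rightarrow> complex \<Rightarrow> real" where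
  "conway_A A B C = ((dist C A)\<^sup>2 + (dist A B)\<^sup>2 - (dist B C)\<^sup>2) / 2"

definition conway_B :: "complex \<Rightarrow> complex \<Rightarrow> complex \<Rightarrow> real" where
  "conway_B A B C = ((dist A B)\<^sup>2 + (dist B C)\<^sup>2 - (dist C A)\<^sup>2) / 2"

definition conway_C :: "complex \<Rightarrow> complex \<Rightarrow> complex \<Rightarrow> real" where
  "conway_C A B C = ((dist B C)\<^sup>2 + (dist C A)\<^sup>2 - (dist A B)\<^sup>2) / 2"

definition conway_matrix :: "complex \<Rightarrow> complex \<Rightarrow> complex \<Rightarrow> real^3^3" where
  "conway_matrix A B C =
    vector [vector [conway_A A B C, 0, 0],
            vector [0, conway_B A B C, 0],
            vector [0, 0, conway_C A B C]]"

definition oriented_area :: "complex \<Rightarrow> complex \<Rightarrow> complex \<Rightarrow> real" where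
  "oriented_area X Y Z =
    det (vector [vector [Re X, Re Y, Re Z],
                 vector [Im X, Im Y, Im Z],
                 vector [1, 1, 1]] :: real^3^3) / 2"

definition row_det :: "real^3 \<Rightarrow> real^3 \<Rightarrow> real^3 \<Rightarrow> real" where
  "row_det p q r = det (vector [p, q, r] :: real^3^3)"

text \<open>
  The directed angle at \<open>P\<close> from ray \<open>PQ\<close> to ray \<open>PR\<close>, positive counterclockwise, with
  representative in the interval from \<open>-pi\<close> (excluded) to \<open>pi\<close> (included). The lemmas
  \<open>sin_directed_angle\<close> and \<open>cos_directed_angle\<close> confirm the sign convention.
\<close>

definition directed_angle :: "complex \<Rightarrow> complex \<Rightarrow> complex \<Rightarrow> real" where
  "directed_angle Q P R = Arg ((R - P) / (Q - P))"

lemma oriented_area_eq: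
  "2 * oriented_area X Y Z = (Re Y - Re X) * (Im Z - Im X) - (Re Z - Re X) * (Im Y - Im X)"
proof -
  have "2 * oriented_area X Y Z = det (vector [vector [Re X, Re Y, Re Z],
      vector [Im X, Im Y, Im Z], vector [1, 1, 1]] :: real^3^3)"
    by (simp add: oriented_area_def)
  also have "\<dots> = (Re Y - Re X) * (Im Z - Im X) - (Re Z - Re X) * (Im Y - Im X)"
    by (simp add: det_3 algebra_simps)
  finally show ?thesis .
qed

lemma dist_mult_cis_directed_angle:
  assumes "Q \<noteq> P" "R \<noteq> P"
  shows "of_real (dist P Q * dist P R) * cis (directed_angle Q P R) = (R - P) * cnj (Q - P)"
proof -
  define x where "x = (R - P) * cnj (Q - P)"
  have x0: "x \<noteq> 0" using assms by (simp add: x_def)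
  have "(R - P) / (Q - P) = (1 / (norm (Q - P))\<^sup>2) *\<^sub>R x"
    by (simp add: complex_div_cnj[of "R - P" "Q - P"] x_def scaleR_conv_of_real)
  then have "sgn ((R - P) / (Q - P)) = sgn x"
    using assms by (simp only: sgn_scaleR) simp
  then have "cis (directed_angle Q P R) = sgn x"
    using assms by (simp add: directed_angle_def cis_Arg)
  moreover have "norm x = dist P Q * dist P R"
    by (simp only: x_def norm_mult complex_mod_cnj dist_norm norm_minus_commute mult.commute)
  moreover have "of_real (norm x) * sgn x = x"
    using x0 by (simp add: sgn_div_norm scaleR_conv_of_real)
  ultimately show ?thesis
    by (simp only: x_def)
qed

lemma sin_directed_angle:
  assumes "Q \<noteq> P" "R \<noteq> P"
  shows "dist P Q * dist P R * sin (directed_angle Q P R) = 2 * oriented_area P Q R"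
  using arg_cong[OF dist_mult_cis_directed_angle[OF assms], of Im]
  by (simp add: oriented_area_eq algebra_simps)

lemma cos_directed_angle:
  assumes "Q \<noteq> P" "R \<noteq> P"
  shows "dist P Q * dist P R * cos (directed_angle Q P R) = (Q - P) \<bullet> (R - P)"
  using arg_cong[OF dist_mult_cis_directed_angle[OF assms], of Re]
  by (simp add: inner_complex_def algebra_simps)

lemma oriented_area_nonzero:
  fixes A B C :: complex
  assumes "\<not> collinear {A, B, C}"
  shows "oriented_area A B C \<noteq> 0"
proof
  assume 0: "oriented_area A B C = 0"
  have BA: "B \<noteq> A" using assms by (auto simp: collinear_2 insert_commute)
  have "Im ((C - A) * cnj (B - A)) = 0"
    using 0 oriented_area_eq[of A B C] by (simp add: algebra_simps)
  then have "(C - A) / (B - A) \<in> \<real>"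
    using BA by (simp add: complex_is_Real_iff complex_div_cnj[of "C - A" "B - A"] Im_divide_of_real)
  then obtain t where "(C - A) / (B - A) = of_real t" by (auto elim: Reals_cases)
  then have "C - A = t *\<^sub>R (B - A)" using BA by (simp add: field_simps scaleR_conv_of_real)
  then have "collinear {0, B - A, C - A}" by (auto simp: collinear_lemma)
  then have "collinear {B, A, C}" using collinear_3[of B A C] by simp
  then show False using assms by (simp add: insert_commute)
qed

lemma bary_exists_unique:
  fixes A B C P :: complex
  assumes "\<not> collinear {A, B, C}"
  shows "\<exists>!v::real^3. v $ 1 + v $ 2 + v $ 3 = 1 \<and>
    P = v $ 1 *\<^sub>R A + v $ 2 *\<^sub>R B + v $ 3 *\<^sub>R C"
proof -
  define D where "D = 2 * oriented_area A B C"
  have D0: "D \<noteq> 0" using oriented_area_nonzero[OF assms] by (simp add: D_def)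
  have D: "D = (Re B - Re A) * (Im C - Im A) - (Re C - Re A) * (Im B - Im A)"
    by (simp add: D_def oriented_area_eq)
  define y where "y = ((Re P - Re A) * (Im C - Im A) - (Re C - Re A) * (Im P - Im A)) / D"
  define z where "z = ((Re B - Re A) * (Im P - Im A) - (Re P - Re A) * (Im B - Im A)) / D"
  have y: "y * D = (Re P - Re A) * (Im C - Im A) - (Re C - Re A) * (Im P - Im A)"
    and z: "z * D = (Re B - Re A) * (Im P - Im A) - (Re P - Re A) * (Im B - Im A)"
    using D0 by (simp_all add: y_def z_def)
  have iff: "P = (1 - s - t) *\<^sub>R A + s *\<^sub>R B + t *\<^sub>R C \<longleftrightarrow> s = y \<and> t = z" for s t
  proof
    assume "P = (1 - s - t) *\<^sub>R A + s *\<^sub>R B + t *\<^sub>R C"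
    then have e: "Re P - Re A = s * (Re B - Re A) + t * (Re C - Re A)"
      "Im P - Im A = s * (Im B - Im A) + t * (Im C - Im A)"
      by (simp_all add: complex_eq_iff algebra_simps)
    have "y * D = s * D" "z * D = t * D"
      unfolding y z e by (simp_all add: D algebra_simps)
    then show "s = y \<and> t = z" using D0 by simp
  next
    assume st: "s = y \<and> t = z"
    have "D * (Re P - Re A) = (y * D) * (Re B - Re A) + (z * D) * (Re C - Re A)"
      "D * (Im P - Im A) = (y * D) * (Im B - Im A) + (z * D) * (Im C - Im A)"
      unfolding y z by (simp_all add: D algebra_simps)
    then have "D * (Re P - Re A) = D * (y * (Re B - Re A) + z * (Re C - Re A))"
      "D * (Im P - Im A) = D * (y * (Im B - Im A) + z * (Im C - Im A))"
      by (simp_all add: algebra_simps)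
    then have "Re P - Re A = y * (Re B - Re A) + z * (Re C - Re A)"
      "Im P - Im A = y * (Im B - Im A) + z * (Im C - Im A)"
      using D0 by (auto simp only: mult_cancel_left)
    then show "P = (1 - s - t) *\<^sub>R A + s *\<^sub>R B + t *\<^sub>R C"
      using st by (simp add: complex_eq_iff algebra_simps)
  qed
  show ?thesis
  proof (rule ex1I[of _ "vector [1 - y - z, y, z]"])
    define w :: "real^3" where "w = vector [1 - y - z, y, z]"
    have "w $ 1 + w $ 2 + w $ 3 = 1 \<and> P = w $ 1 *\<^sub>R A + w $ 2 *\<^sub>R B + w $ 3 *\<^sub>R C"
      using iff[of y z] by (simp add: w_def)
    then show "(vector [1 - y - z, y, z] :: real^3) $ 1 + (vector [1 - y - z, y, z] :: real^3) $ 2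
        + (vector [1 - y - z, y, z] :: real^3) $ 3 = 1 \<and>
      P = (vector [1 - y - z, y, z] :: real^3) $ 1 *\<^sub>R A
        + (vector [1 - y - z, y, z] :: real^3) $ 2 *\<^sub>R B
        + (vector [1 - y - z, y, z] :: real^3) $ 3 *\<^sub>R C"
      by (simp only: w_def)
  next
    fix v :: "real^3"
    assume v: "v $ 1 + v $ 2 + v $ 3 = 1 \<and> P = v $ 1 *\<^sub>R A + v $ 2 *\<^sub>R B + v $ 3 *\<^sub>R C"
    then have v1: "v $ 1 = 1 - v $ 2 - v $ 3" by simp
    then have "v $ 2 = y \<and> v $ 3 = z" using v iff[of "v $ 2" "v $ 3"] by simp
    then show "v = vector [1 - y - z, y, z]" using v1 by (simp add: vec_eq_iff forall_3)
  qed
qed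

end

theory Submission
  imports Defs
begin

text \<open>
  The cotangent of the angle at \<open>P\<close> is the quotient of its cosine and sine, that is, of the inner
  product \<open>(Q - P) \<bullet> (R - P)\<close> and twice the oriented area of \<open>PQR\<close>: the common factor
  \<open>|PQ| |PR|\<close> cancels. It remains to express both quantities in barycentric coordinates.

  The area is a determinant of homogeneous Cartesian coordinates. Since barycentric coordinates
  are linear and sum to \<open>1\<close>, the homogeneous Cartesian matrix of \<open>PQR\<close> is the one of \<open>ABC\<close> times
  the transposed matrix of barycentric rows, so the areas differ by the factor \<open>[P;Q;R]\<close>
  (\<open>oriented_area_barycentric\<close>).

  The difference of two barycentric vectors has coordinate sum zero and describes a displacement.
  On such vectors the Euclidean inner product is the diagonal form with matrix \<open>K\<close>
  (\<open>inner_barycentric_displacements\<close>), because the sides out of \<open>A\<close> have the Gram matrix with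
  entries \<open>S\<^sub>A + S\<^sub>B\<close>, \<open>S\<^sub>A\<close>, \<open>S\<^sub>A + S\<^sub>C\<close>. Replacing both \<open>Q - P\<close> and \<open>R - P\<close> by their
  negatives leaves the inner product unchanged, which gives the numerator \<open>(P - Q) K (P - R)\<^sup>T\<close>.
\<close>

lemma bary_coordinates:
  assumes "\<not> collinear {A, B, C}"
  shows bary_sum: "bary A B C P $ 1 + bary A B C P $ 2 + bary A B C P $ 3 = 1"
    and bary_position:
      "P = bary A B C P $ 1 *\<^sub>R A + bary A B C P $ 2 *\<^sub>R B + bary A B C P $ 3 *\<^sub>R C"
  using theI'[OF bary_exists_unique[OF assms, of P]] by (simp_all only: bary_def)

lemma conway_form:
  "(u v* conway_matrix A B C) \<bullet> w =
    conway_A A B C * u $ 1 * w $ 1 + conway_B A B C * u $ 2 * w $ 2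
      + conway_C A B C * u $ 3 * w $ 3"
  by (simp add: conway_matrix_def vector_matrix_mult_def inner_vec_def sum_3)

text \<open>
  The law of cosines turns the Conway symbols into inner products; these are the sides' Gram
  matrix entries.
\<close>

lemma conway_gram:
  shows "(B - A) \<bullet> (C - A) = conway_A A B C"
    and "(B - A) \<bullet> (B - A) = conway_A A B C + conway_B A B C"
    and "(C - A) \<bullet> (C - A) = conway_A A B C + conway_C A B C"
  by (simp_all add: conway_A_def conway_B_def conway_C_def dist_norm power2_norm_eq_inner
      inner_diff_left inner_diff_right inner_commute field_simps)

text \<open>
  Vanishing coordinate sums make the displacements combinations of \<open>B - A\<close> and \<open>C - A\<close> alone.
  Expanding their inner product by the Gram matrix, the coefficient of \<open>S\<^sub>A\<close> is
  \<open>(u\<^sub>2 + u\<^sub>3) (w\<^sub>2 + w\<^sub>3) = u\<^sub>1 w\<^sub>1\<close>, and no mixed products survive.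
\<close>

lemma inner_barycentric_displacements:
  fixes u w :: "real^3"
  assumes "u $ 1 + u $ 2 + u $ 3 = 0" and "w $ 1 + w $ 2 + w $ 3 = 0"
  shows "(u $ 1 *\<^sub>R A + u $ 2 *\<^sub>R B + u $ 3 *\<^sub>R C) \<bullet> (w $ 1 *\<^sub>R A + w $ 2 *\<^sub>R B + w $ 3 *\<^sub>R C)
    = (u v* conway_matrix A B C) \<bullet> w"
proof -
  have u1: "u $ 1 = - u $ 2 - u $ 3" and w1: "w $ 1 = - w $ 2 - w $ 3"
    using assms by simp_all
  have "u $ 1 *\<^sub>R A + u $ 2 *\<^sub>R B + u $ 3 *\<^sub>R C = u $ 2 *\<^sub>R (B - A) + u $ 3 *\<^sub>R (C - A)"
    and "w $ 1 *\<^sub>R A + w $ 2 *\<^sub>R B + w $ 3 *\<^sub>R C = w $ 2 *\<^sub>R (B - A) + w $ 3 *\<^sub>R (C - A)"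
    by (simp_all add: u1 w1 algebra_simps)
  moreover have "(u $ 2 *\<^sub>R (B - A) + u $ 3 *\<^sub>R (C - A)) \<bullet> (w $ 2 *\<^sub>R (B - A) + w $ 3 *\<^sub>R (C - A))
    = u $ 2 * w $ 2 * ((B - A) \<bullet> (B - A)) + (u $ 2 * w $ 3 + u $ 3 * w $ 2) * ((B - A) \<bullet> (C - A))
      + u $ 3 * w $ 3 * ((C - A) \<bullet> (C - A))"
    by (simp only: inner_add_left inner_add_right inner_scaleR_left inner_scaleR_right
        inner_commute[of "C - A" "B - A"]) (simp only: algebra_simps)
  ultimately show ?thesis
    by (simp only: conway_gram(1)[of B A C] conway_gram(2)[of B A C] conway_gram(3)[of C A B]
        conway_form u1 w1)
      (simp add: algebra_simps)
qed

text \<open>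
  The third row of ones in the Cartesian matrix is where the normalization of the coordinates
  enters; it makes the affine change of coordinates a matrix product.
\<close>

lemma oriented_area_barycentric:
  assumes "\<not> collinear {A, B, C}"
  shows "oriented_area P Q R =
    oriented_area A B C * row_det (bary A B C P) (bary A B C Q) (bary A B C R)"
proof -
  define cart :: "complex \<Rightarrow> complex \<Rightarrow> complex \<Rightarrow> real^3^3" where
    "cart X Y Z = vector [vector [Re X, Re Y, Re Z], vector [Im X, Im Y, Im Z],
      vector [1, 1, 1]]" for X Y Z
  define N :: "real^3^3" where "N = vector [bary A B C P, bary A B C Q, bary A B C R]"
  have Re: "Re X = Re A * bary A B C X $ 1 + Re B * bary A B C X $ 2 + Re C * bary A B C X $ 3"
    and Im: "Im X = Im A * bary A B C X $ 1 + Im B * bary A B C X $ 2 + Im C * bary A B C X $ 3"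
    for X
    using arg_cong[OF bary_position[OF assms, of X], of Re]
      arg_cong[OF bary_position[OF assms, of X], of Im]
    by (simp_all add: mult.commute)
  have "cart P Q R = cart A B C ** transpose N"
    by (simp add: vec_eq_iff forall_3 cart_def N_def matrix_matrix_mult_def transpose_def sum_3
        bary_sum[OF assms] Re[symmetric] Im[symmetric])
  then have "det (cart P Q R) = det (cart A B C) * det N"
    by (simp add: det_mul)
  then show ?thesis
    by (simp add: oriented_area_def row_det_def cart_def N_def)
qed

lemma cot_directed_angle:
  assumes "Q \<noteq> P" "R \<noteq> P"
  shows "cot (directed_angle Q P R) = ((P - Q) \<bullet> (P - R)) / (2 * oriented_area P Q R)"
proof -
  have "cot (directed_angle Q P R) = (dist P Q * dist P R * cos (directed_angle Q P R))
      / (dist P Q * dist P R * sin (directed_angle Q P R))"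
    using assms by (simp add: cot_def)
  also have "\<dots> = ((Q - P) \<bullet> (R - P)) / (2 * oriented_area P Q R)"
    by (simp only: sin_directed_angle[OF assms] cos_directed_angle[OF assms])
  also have "(Q - P) \<bullet> (R - P) = (P - Q) \<bullet> (P - R)"
    by (simp add: inner_diff_left inner_diff_right)
  finally show ?thesis .
qed

theorem theorem2:
  fixes A B C P Q R :: complex
  assumes "\<not> collinear {A, B, C}"
    and "\<not> collinear {P, Q, R}"
  defines "p \<equiv> bary A B C P" and "q \<equiv> bary A B C Q" and "r \<equiv> bary A B C R"
  shows "cot (directed_angle Q P R) =
    (((p - q) v* conway_matrix A B C) \<bullet> (p - r)) / (2 * oriented_area A B C * row_det p q r)"
proof -
  have ne: "Q \<noteq> P" "R \<noteq> P"
    using assms(2) by (auto simp: insert_commute)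
  have displacement: "X - Y = (bary A B C X - bary A B C Y) $ 1 *\<^sub>R A
      + (bary A B C X - bary A B C Y) $ 2 *\<^sub>R B + (bary A B C X - bary A B C Y) $ 3 *\<^sub>R C" for X Y
    using arg_cong2[OF bary_position[OF assms(1), of X] bary_position[OF assms(1), of Y], of "(-)"]
    by (simp add: algebra_simps)
  have sum0: "(bary A B C X - bary A B C Y) $ 1 + (bary A B C X - bary A B C Y) $ 2
      + (bary A B C X - bary A B C Y) $ 3 = 0" for X Y
    using bary_sum[OF assms(1), of X] bary_sum[OF assms(1), of Y] by simp
  have "(P - Q) \<bullet> (P - R) = ((p - q) v* conway_matrix A B C) \<bullet> (p - r)"
    unfolding p_def q_def r_def
    by (subst displacement[of P Q], subst displacement[of P R])
      (rule inner_barycentric_displacements[OF sum0 sum0])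
  then show ?thesis
    by (simp add: cot_directed_angle[OF ne] oriented_area_barycentric[OF assms(1), of P Q R]
        p_def q_def r_def)
qed

end
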